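(* Let $H_1$ and $H_2$ be graphs with at least one edge each, and let $p\in(0,1)$ be such that $p^{e(H_1)}=(1-p)^{e(H_2)}$. If $H_1$ and $H_2$ are Sidorenko, then $c(H_1,H_2)=2p^{e(H_1)}=2(1-p)^{e(H_2)}$.
   Context: $e(H)$ is the number of edges of $H$. For graphs $H,G$, $t(H,G)=\hom(H,G)/v(G)^{v(H)}$ is the probability that a uniformly random map $V(H)\to V(G)$ is a homomorphism. A graph $H$ is Sidorenko if $t(H,G)\ge t(K_2,G)^{e(H)}$ for every graph $G$. Let $G_1,G_2,\dots$ be a sequence containing every finite graph exactly once; $\overline{G}$ is the complement of $G$. For $\lambda\in[0,2]$, $c_\lambda(H_1,H_2):=\liminf_{n\to\infty}\left[\lambda\, t(H_1,G_n)+(2-\lambda)\, t(H_2,\overline{G_n})\right]$, and $c(H_1,H_2):=\sup_{\lambda\in[0,2]}c_\lambda(H_1,H_2)$. *)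

theory Defs
  imports "HOL-Analysis.Analysis" "HOL-Library.Ramsey"
begin

record 'a sgraph =
  verts :: "'a set"
  edges :: "'a set set"

text \<open>Graphs are finite and simple, with a nonempty vertex set (so that homomorphism
  densities into them are well defined).\<close>

definition is_graph :: "'a sgraph \<Rightarrow> bool" where
  "is_graph G \<longleftrightarrow> finite (verts G) \<and> verts G \<noteq> {} \<and> edges G \<subseteq> nsets (verts G) 2"

definition num_verts :: "'a sgraph \<Rightarrow> nat" where
  "num_verts G = card (verts G)"

definition num_edges :: "'a sgraph \<Rightarrow> nat" where
  "num_edges G = card (edges G)"

definition complement :: "'a sgraph \<Rightarrow> 'a sgraph" where
  "complement G = \<lparr>verts = verts G, edges = nsets (verts G) 2 - edges G\<rparr>"

definition isomorphic :: "'a sgraph \<Rightarrow> 'b sgraph \<Rightarrow> bool" where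
  "isomorphic G G' \<longleftrightarrow>
     (\<exists>f. bij_betw f (verts G) (verts G') \<and> edges G' = (\<lambda>e. f ` e) ` edges G)"

text \<open>Edges of the target have two elements, so the condition on edges also
  excludes maps that identify adjacent vertices. Extensionality makes the set of
  homomorphisms a set of maps on the vertices of the source only.\<close>

definition homs :: "'a sgraph \<Rightarrow> 'b sgraph \<Rightarrow> ('a \<Rightarrow> 'b) set" where
  "homs H G = {f \<in> verts H \<rightarrow>\<^sub>E verts G. \<forall>e \<in> edges H. f ` e \<in> edges G}"

definition hom_density :: "'a sgraph \<Rightarrow> 'b sgraph \<Rightarrow> real" where
  "hom_density H G = real (card (homs H G)) / real (num_verts G) ^ num_verts H"

definition K2 :: "nat sgraph" where
  "K2 = \<lparr>verts = {0, 1}, edges = {{0, 1}}\<rparr>"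

text \<open>Every finite graph is isomorphic to one on natural numbers, so it
  suffices to let the target graph range over those.\<close>

definition sidorenko :: "'a sgraph \<Rightarrow> bool" where
  "sidorenko H \<longleftrightarrow>
     (\<forall>G :: nat sgraph. is_graph G \<longrightarrow> hom_density H G \<ge> hom_density K2 G ^ num_edges H)"

text \<open>A sequence containing every finite graph exactly once, up to isomorphism.\<close>

definition graph_enumeration :: "(nat \<Rightarrow> nat sgraph) \<Rightarrow> bool" where
  "graph_enumeration G \<longleftrightarrow>
     (\<forall>n. is_graph (G n)) \<and> (\<forall>F :: nat sgraph. is_graph F \<longrightarrow> (\<exists>!n. isomorphic F (G n)))"

text \<open>The limit inferior and the supremum are taken in the extended reals, where they
  always exist; the graph sequence is an explicit parameter.\<close>

definition c_lam :: "(nat \<Rightarrow> nat sgraph) \<Rightarrow> real \<Rightarrow> 'a sgraph \<Rightarrow> 'b sgraph \<Rightarrow> ereal" where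
  "c_lam G lam H1 H2 =
     liminf (\<lambda>n. ereal (lam * hom_density H1 (G n)
                       + (2 - lam) * hom_density H2 (complement (G n))))"

definition c_sup :: "(nat \<Rightarrow> nat sgraph) \<Rightarrow> 'a sgraph \<Rightarrow> 'b sgraph \<Rightarrow> ereal" where
  "c_sup G H1 H2 = (SUP lam \<in> {0..2}. c_lam G lam H1 H2)"

end

theory Submission
  imports Defs
begin

text \<open>Choose \<open>\<lambda>\<close> so that the tangent lines of \<open>\<lambda> x\<^bsup>e(H\<^sub>1)\<^esup>\<close> at \<open>p\<close> and of
  \<open>(2 - \<lambda>) y\<^bsup>e(H\<^sub>2)\<^esup>\<close> at \<open>1 - p\<close> have the same slope. As the edge densities of a graph
  on \<open>n\<close> vertices and of its complement add up to \<open>1 - 1/n\<close>, the Sidorenko property and these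
  tangent lines give the lower bound. For the upper bound, for every \<open>\<lambda>\<close> and every number \<open>n\<close> of
  vertices, some graph is at most as bad as the average over the binomial random graph
  \<open>G(n, p)\<close>, in which an injective map from \<open>H\<^sub>1\<close> is a homomorphism with probability
  \<open>p\<^bsup>e(H\<^sub>1)\<^esup>\<close>, and non-injective maps form a vanishing proportion.\<close>

section \<open>Homomorphism densities\<close>

lemma is_graph_complement: "is_graph G \<Longrightarrow> is_graph (complement G)"
  by (auto simp: is_graph_def complement_def)

lemma num_verts_complement [simp]: "num_verts (complement G) = num_verts G"
  by (simp add: num_verts_def complement_def)

lemma num_verts_pos: "is_graph G \<Longrightarrow> num_verts G > 0"
  by (simp add: is_graph_def num_verts_def card_gt_0_iff)

lemma finite_homs:
  assumes "finite (verts H)" "finite (verts G)"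
  shows "finite (homs H G)"
  unfolding homs_def using finite_PiE[of "verts H" "\<lambda>_. verts G"] assms by simp

text \<open>With \<open>n\<close> the number of vertices, a map from \<open>K2\<close> is an ordered
  pair of vertices. Each of the \<open>n * (n - 1)\<close> pairs with distinct entries is an edge of
  exactly one of the two graphs; the missing \<open>1 / n\<close> is the diagonal.\<close>

lemma K2_density_complement:
  assumes "is_graph G"
  shows "hom_density K2 G + hom_density K2 (complement G) = 1 - 1 / num_verts G"
proof -
  let ?I = "{f \<in> {0, 1::nat} \<rightarrow>\<^sub>E verts G. inj_on f {0, 1}}"
  have fin: "finite (verts G)" using assms by (simp add: is_graph_def)
  have K2: "verts K2 = {0, 1}" "finite (verts K2)" "num_verts K2 = 2"
    by (simp_all add: K2_def num_verts_def)
  have "edges G \<subseteq> nsets (verts G) 2" using assms by (simp add: is_graph_def)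
  then have edge: "f 0 \<noteq> f (Suc 0)" if "{f 0, f (Suc 0)} \<in> edges G" for f :: "nat \<Rightarrow> 'a"
    using that by (metis doubleton_in_nsets_2 subsetD)
  have "homs K2 G \<union> homs K2 (complement G) = ?I"
    using edge by (auto simp: homs_def K2_def complement_def PiE_iff)
  moreover have "homs K2 G \<inter> homs K2 (complement G) = {}"
    by (auto simp: homs_def K2_def complement_def)
  moreover have "finite (verts (complement G))" using fin by (simp add: complement_def)
  ultimately have "card (homs K2 G) + card (homs K2 (complement G)) = card ?I"
    using card_Un_disjoint[of "homs K2 G" "homs K2 (complement G)"] fin K2(2)
    by (simp add: finite_homs)
  also have "\<dots> = num_verts G * (num_verts G - 1)"
    using card_inj_on_subset_funcset[of "{0, 1::nat}" "verts G" "{0, 1}"] fin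
    by (simp add: num_verts_def numeral_2_eq_2)
  finally have "real (card (homs K2 G)) + real (card (homs K2 (complement G)))
      = real (num_verts G) * (real (num_verts G) - 1)"
    using num_verts_pos[OF assms] by (metis of_nat_add of_nat_mult of_nat_1 of_nat_diff Suc_leI One_nat_def)
  moreover have "real (num_verts G) * (real (num_verts G) - 1) / real (num_verts G) ^ 2
      = 1 - 1 / num_verts G"
    using num_verts_pos[OF assms] by (simp add: field_simps power2_eq_square)
  ultimately show ?thesis
    by (simp add: hom_density_def K2 add_divide_distrib[symmetric])
qed

section \<open>Invariance of homomorphism densities under isomorphism\<close>

lemma isomorphic_sym:
  assumes "is_graph F" "isomorphic F G"
  shows "isomorphic G F"
proof -
  obtain f where f: "bij_betw f (verts F) (verts G)" "edges G = (\<lambda>e. f ` e) ` edges F"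
    using assms(2) by (auto simp: isomorphic_def)
  let ?g = "the_inv_into (verts F) f"
  have "?g ` f ` e = e" if "e \<in> edges F" for e
    using that assms(1) f(1)
    by (force simp: is_graph_def nsets_def image_image bij_betw_def the_inv_into_f_f)
  then have "edges F = (\<lambda>e. ?g ` e) ` edges G"
    by (simp add: f(2) image_image)
  then show ?thesis
    using bij_betw_the_inv_into[OF f(1)] by (auto simp: isomorphic_def)
qed

lemma isomorphic_complement:
  assumes "is_graph F" "isomorphic F G"
  shows "isomorphic (complement F) (complement G)"
proof -
  obtain f where f: "bij_betw f (verts F) (verts G)" "edges G = (\<lambda>e. f ` e) ` edges F"
    using assms(2) by (auto simp: isomorphic_def)
  have "bij_betw (\<lambda>e. f ` e) (nsets (verts F) 2) (nsets (verts G) 2)"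
    using bij_betw_nsets[OF f(1)] .
  then have "(\<lambda>e. f ` e) ` (nsets (verts F) 2 - edges F) = nsets (verts G) 2 - edges G"
    using assms(1) unfolding f(2) is_graph_def bij_betw_def
    by (simp add: inj_on_image_set_diff[of _ "nsets (verts F) 2"])
  then show ?thesis
    using f(1) unfolding isomorphic_def complement_def
    by (intro exI[of _ f]) simp
qed

text \<open>Composing with the isomorphism is an injection between the homomorphism sets. One
  inequality is enough, since the inverse isomorphism gives the other.\<close>

lemma card_homs_le_isomorphic:
  assumes "isomorphic F G" "is_graph H" "finite (verts G)"
  shows "card (homs H F) \<le> card (homs H G)"
proof -
  obtain f where f: "bij_betw f (verts F) (verts G)" "edges G = (\<lambda>e. f ` e) ` edges F"
    using assms(1) by (auto simp: isomorphic_def)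
  \<comment> \<open>Members of \<open>homs\<close> are extensional, so the composition has to be cut
    back to the vertices of \<open>H\<close>.\<close>
  let ?\<phi> = "\<lambda>g. restrict (f \<circ> g) (verts H)"
  have "inj_on ?\<phi> (homs H F)"
  proof (rule inj_onI)
    fix g h assume gh: "g \<in> homs H F" "h \<in> homs H F" "?\<phi> g = ?\<phi> h"
    show "g = h"
    proof (rule PiE_ext[of _ "verts H" "\<lambda>_. verts F"])
      fix x assume x: "x \<in> verts H"
      with fun_cong[OF gh(3), of x] have "f (g x) = f (h x)" by simp
      then show "g x = h x"
        using x gh(1,2) inj_onD[OF bij_betw_imp_inj_on[OF f(1)], of "g x" "h x"]
        by (auto simp: homs_def)
    qed (use gh in \<open>auto simp: homs_def\<close>)
  qed
  moreover have "?\<phi> ` homs H F \<subseteq> homs H G"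
  proof (clarify)
    fix g assume g: "g \<in> homs H F"
    have "?\<phi> g ` e \<in> edges G" if e: "e \<in> edges H" for e
    proof -
      have "e \<subseteq> verts H" using e assms(2) by (auto simp: is_graph_def nsets_def)
      then have "?\<phi> g ` e = f ` g ` e" by (force simp: image_iff)
      then show ?thesis using g e f(2) by (auto simp: homs_def)
    qed
    moreover have "?\<phi> g \<in> verts H \<rightarrow>\<^sub>E verts G"
      using g bij_betwE[OF f(1)] by (auto simp: homs_def PiE_iff)
    ultimately show "?\<phi> g \<in> homs H G" by (simp add: homs_def)
  qed
  moreover have "finite (homs H G)"
    using assms by (intro finite_homs) (auto simp: is_graph_def)
  ultimately show ?thesis by (rule card_inj_on_le)
qed

lemma num_verts_isomorphic: "isomorphic F G \<Longrightarrow> num_verts F = num_verts G"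
  by (auto simp: isomorphic_def num_verts_def bij_betw_same_card)

lemma hom_density_isomorphic:
  assumes "isomorphic F G" "is_graph H" "is_graph F" "is_graph G"
  shows "hom_density H F = hom_density H G"
proof -
  have "card (homs H F) = card (homs H G)"
    using card_homs_le_isomorphic[OF assms(1,2)] assms
      card_homs_le_isomorphic[OF isomorphic_sym[OF assms(3,1)] assms(2)]
    by (simp add: is_graph_def)
  then show ?thesis by (simp add: hom_density_def num_verts_isomorphic[OF assms(1)])
qed

section \<open>Enumerations of all finite graphs\<close>

text \<open>Every listed graph with \<open>n\<close> vertices has a copy on \<open>{..<n}\<close>.
  Choosing one labels its index by a subset of the finite set of pairs, and since each isomorphism
  type is listed only once, different indices get different labels.\<close>

lemma finite_num_verts_eq:
  assumes "graph_enumeration G"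
  shows "finite {k. num_verts (G k) = n}"
proof -
  have G: "is_graph (G k)" for k using assms by (simp add: graph_enumeration_def)
  have ex: "\<exists>E. E \<subseteq> nsets {..<n} 2 \<and> isomorphic \<lparr>verts = {..<n}, edges = E\<rparr> (G k)"
    if k: "num_verts (G k) = n" for k
  proof -
    obtain f where f: "bij_betw f (verts (G k)) {..<n}"
      using k G[of k] finite_same_card_bij[of "verts (G k)" "{..<n}"]
      by (auto simp: is_graph_def num_verts_def)
    let ?E = "(\<lambda>e. f ` e) ` edges (G k)"
    have "isomorphic (G k) \<lparr>verts = {..<n}, edges = ?E\<rparr>"
      using f by (auto simp: isomorphic_def)
    moreover have "?E \<subseteq> nsets {..<n} 2"
      using bij_betw_nsets[OF f, of 2] G[of k] by (auto simp: is_graph_def bij_betw_def)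
    ultimately show ?thesis using isomorphic_sym[OF G] by blast
  qed
  define E where "E k = (SOME E. E \<subseteq> nsets {..<n} 2 \<and>
      isomorphic \<lparr>verts = {..<n}, edges = E\<rparr> (G k))" for k
  have E: "E k \<subseteq> nsets {..<n} 2" "isomorphic \<lparr>verts = {..<n}, edges = E k\<rparr> (G k)"
    if "num_verts (G k) = n" for k
    using someI_ex[OF ex[OF that]] unfolding E_def by auto
  have "inj_on E {k. num_verts (G k) = n}"
  proof (rule inj_onI, clarify)
    fix k l assume kl: "num_verts (G l) = num_verts (G k)" "n = num_verts (G k)" "E k = E l"
    have "is_graph \<lparr>verts = {..<n}, edges = E k\<rparr>"
      using E(1)[of k] kl(2) num_verts_pos[OF G[of k]] by (auto simp: is_graph_def lessThan_empty_iff)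
    then have "\<exists>!j. isomorphic \<lparr>verts = {..<n}, edges = E k\<rparr> (G j)"
      using assms by (simp add: graph_enumeration_def)
    then show "k = l" using E(2)[of k] E(2)[of l] kl by auto
  qed
  moreover have "finite (E ` {k. num_verts (G k) = n})"
    by (rule finite_subset[of _ "Pow (nsets {..<n} 2)"])
       (use E(1) in \<open>auto simp: finite_imp_finite_nsets\<close>)
  ultimately show ?thesis using finite_imageD by blast
qed

text \<open>This turns limits in the number of vertices into limits along the enumeration.\<close>

lemma filterlim_num_verts:
  assumes "graph_enumeration G"
  shows "filterlim (\<lambda>k. num_verts (G k)) at_top sequentially"
  unfolding filterlim_at_top
proof
  fix m
  have "{k. \<not> m \<le> num_verts (G k)} = (\<Union>n<m. {k. num_verts (G k) = n})" by auto
  then have "finite {k. \<not> m \<le> num_verts (G k)}"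
    using finite_num_verts_eq[OF assms] by simp
  then show "eventually (\<lambda>k. m \<le> num_verts (G k)) sequentially"
    by (simp add: eventually_cofinite flip: cofinite_eq_sequentially)
qed

section \<open>The average over the binomial random graph\<close>

text \<open>For finite \<open>U\<close> and \<open>S\<close> a subset of it, this is the probability
  that a random subset of \<open>U\<close>, containing each element independently with probability
  \<open>p\<close>, equals \<open>S\<close>. With \<open>U\<close> the set of pairs of vertices it
  is the distribution of G(n, p).\<close>

definition binomial_weight :: "real \<Rightarrow> 'a set \<Rightarrow> 'a set \<Rightarrow> real" where
  "binomial_weight p U S = p ^ card S * (1 - p) ^ card (U - S)"

lemma binomial_weight_nonneg: "0 \<le> p \<Longrightarrow> p \<le> 1 \<Longrightarrow> binomial_weight p U S \<ge> 0"
  by (simp add: binomial_weight_def)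

lemma binomial_weight_Diff:
  "S \<subseteq> U \<Longrightarrow> binomial_weight p U (U - S) = binomial_weight (1 - p) U S"
  by (simp add: binomial_weight_def double_diff)

text \<open>This is the probability that the random set contains \<open>A\<close>. In the expansion
  of the product over \<open>U\<close> of \<open>p + ?g x\<close>, the zeros of \<open>?g\<close> on
  \<open>A\<close> remove exactly the terms of sets that miss a point of \<open>A\<close>. The
  factors themselves are \<open>p\<close> on \<open>A\<close> and 1 elsewhere.\<close>

lemma sum_binomial_weight_superset:
  assumes "finite U" "A \<subseteq> U"
  shows "(\<Sum>S\<in>Pow U. if A \<subseteq> S then binomial_weight p U S else 0) = p ^ card A"
proof -
  let ?g = "\<lambda>x. if x \<in> A then 0 else 1 - p"
  have "(\<Sum>S\<in>Pow U. if A \<subseteq> S then binomial_weight p U S else 0)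
      = (\<Sum>S\<in>Pow U. (\<Prod>x\<in>S. p) * (\<Prod>x\<in>U - S. ?g x))"
  proof (rule sum.cong[OF refl])
    fix S assume S: "S \<in> Pow U"
    show "(if A \<subseteq> S then binomial_weight p U S else 0) = (\<Prod>x\<in>S. p) * (\<Prod>x\<in>U - S. ?g x)"
    proof (cases "A \<subseteq> S")
      case True
      then have "(\<Prod>x\<in>U - S. ?g x) = (\<Prod>x\<in>U - S. 1 - p)"
        by (intro prod.cong) auto
      with True show ?thesis by (simp add: binomial_weight_def)
    next
      case False
      then have "(\<Prod>x\<in>U - S. ?g x) = 0"
        using assms by (intro prod_zero) auto
      with False show ?thesis by simp
    qed
  qed
  also have "\<dots> = (\<Prod>x\<in>U. p + ?g x)"
    by (rule prod_add[OF assms(1), symmetric])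
  also have "\<dots> = (\<Prod>x\<in>U. if x \<in> A then p else 1)"
    by (intro prod.cong) auto
  also have "\<dots> = p ^ card A"
    using assms by (simp add: prod.If_cases Int_absorb1)
  finally show ?thesis .
qed

lemma sum_binomial_weight: "finite U \<Longrightarrow> (\<Sum>S\<in>Pow U. binomial_weight p U S) = 1"
  using sum_binomial_weight_superset[of U "{}" p] by simp

text \<open>For positive \<open>n\<close>, the probability that a uniformly random map from a set of
  size \<open>v\<close> to a set of size \<open>n\<close> is injective.\<close>

definition inj_ratio :: "nat \<Rightarrow> nat \<Rightarrow> real" where
  "inj_ratio v n = (\<Prod>i<v. 1 - real i / real n)"

lemma inj_ratio_tendsto: "(\<lambda>n. inj_ratio v n) \<longlonglongrightarrow> 1"
proof -
  have "(\<lambda>n. \<Prod>i<v. 1 - real i / real n) \<longlonglongrightarrow> (\<Prod>i<v. 1 - 0)"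
    by (intro tendsto_intros lim_const_over_n)
  then show ?thesis by (simp add: inj_ratio_def)
qed

lemma card_inj_PiE:
  assumes "finite A" "finite B" "card A \<le> card B" "B \<noteq> {}"
  shows "real (card {f \<in> A \<rightarrow>\<^sub>E B. inj_on f A}) = inj_ratio (card A) (card B) * real (card B) ^ card A"
proof -
  have "card {f \<in> A \<rightarrow>\<^sub>E B. inj_on f A} = (\<Prod>i<card A. card B - i)"
    using card_inj_on_subset_funcset[of A B A] assms by (simp add: lessThan_atLeast0)
  also have "real \<dots> = (\<Prod>i<card A. real (card B) - real i)"
    \<comment> \<open>Since \<open>card A\<close> is at most \<open>card B\<close>, no subtraction
      of natural numbers is truncated here.\<close>
    unfolding of_nat_prod using assms(3) by (intro prod.cong) (auto simp: of_nat_diff)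
  also have "\<dots> = (\<Prod>i<card A. (1 - real i / real (card B)) * real (card B))"
    using assms by (intro prod.cong) (auto simp: field_simps)
  finally show ?thesis
    by (simp add: inj_ratio_def prod.distrib)
qed

text \<open>Linearity of expectation: after exchanging the sums, each map \<open>f\<close>
  contributes the probability that it is a homomorphism into the random graph. The term with
  \<open>inj_ratio\<close> pays for the non-injective maps.\<close>

lemma average_hom_density_le:
  assumes H: "is_graph H" and V: "finite V" "V \<noteq> {}" "num_verts H \<le> card V"
    and p: "0 \<le> p" "p \<le> 1"
  shows "(\<Sum>S\<in>Pow (nsets V 2). binomial_weight p (nsets V 2) S * hom_density H \<lparr>verts = V, edges = S\<rparr>)
    \<le> p ^ num_edges H + (1 - inj_ratio (num_verts H) (card V))"
proof -
  let ?U = "nsets V 2" and ?w = "binomial_weight p (nsets V 2)"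
  let ?M = "verts H \<rightarrow>\<^sub>E V"
  let ?I = "{f \<in> ?M. inj_on f (verts H)}"
  let ?N = "real (card V) ^ num_verts H"
  have finU: "finite ?U" using V(1) by (rule finite_imp_finite_nsets)
  have finH: "finite (verts H)" using H by (simp add: is_graph_def)
  have finM: "finite ?M" using finH V(1) by (simp add: finite_PiE)
  have cardM: "real (card ?M) = ?N"
    using finH by (simp add: card_funcsetE num_verts_def)
  have cardI: "real (card ?I) = inj_ratio (num_verts H) (card V) * ?N"
    using card_inj_PiE[OF finH V(1) _ V(2)] V(3) by (simp add: num_verts_def)
  have N: "?N > 0" using V(1,2) by (simp add: card_gt_0_iff)
  \<comment> \<open>An injective map sends the edges of \<open>H\<close> to distinct pairs, so
    exactly \<open>num_edges H\<close> pairs must be present in the random graph.\<close>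
  have inj: "(\<Sum>S\<in>Pow ?U. if (\<lambda>e. f ` e) ` edges H \<subseteq> S then ?w S else 0) = p ^ num_edges H"
    if "f \<in> ?I" for f
  proof -
    have f: "inj_on f (verts H)" "f ` verts H \<subseteq> V" using that by auto
    have "edges H \<subseteq> nsets (verts H) 2" using H by (simp add: is_graph_def)
    moreover have "(\<lambda>e. f ` e) ` nsets (verts H) 2 \<subseteq> ?U"
      using f by (auto simp: nsets_def card_image inj_on_subset)
    moreover have "inj_on (\<lambda>e. f ` e) (edges H)"
      using f(1) calculation(1)
      by (intro inj_on_subset[OF inj_on_image_Pow[OF f(1)]]) (auto simp: nsets_def)
    ultimately show ?thesis
      using sum_binomial_weight_superset[OF finU, of "(\<lambda>e. f ` e) ` edges H" p]
      by (auto simp: card_image num_edges_def)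
  qed
  \<comment> \<open>A non-injective map may send two edges to the same pair, so only the trivial
    bound on a probability is used for it.\<close>
  have noninj: "(\<Sum>S\<in>Pow ?U. if (\<lambda>e. f ` e) ` edges H \<subseteq> S then ?w S else 0) \<le> 1" for f
  proof -
    have "(\<Sum>S\<in>Pow ?U. if (\<lambda>e. f ` e) ` edges H \<subseteq> S then ?w S else 0) \<le> (\<Sum>S\<in>Pow ?U. ?w S)"
      using binomial_weight_nonneg[OF p] by (intro sum_mono) auto
    then show ?thesis using sum_binomial_weight[OF finU] by simp
  qed
  have "(\<Sum>S\<in>Pow ?U. ?w S * real (card (homs H \<lparr>verts = V, edges = S\<rparr>)))
      = (\<Sum>S\<in>Pow ?U. \<Sum>f\<in>?M. if (\<lambda>e. f ` e) ` edges H \<subseteq> S then ?w S else 0)"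
  proof (rule sum.cong[OF refl])
    fix S
    have "homs H \<lparr>verts = V, edges = S\<rparr> = {f \<in> ?M. (\<lambda>e. f ` e) ` edges H \<subseteq> S}"
      by (auto simp: homs_def)
    then show "?w S * real (card (homs H \<lparr>verts = V, edges = S\<rparr>))
        = (\<Sum>f\<in>?M. if (\<lambda>e. f ` e) ` edges H \<subseteq> S then ?w S else 0)"
      using finM by (simp add: sum.inter_filter[symmetric])
  qed
  also have "\<dots> = (\<Sum>f\<in>?M. \<Sum>S\<in>Pow ?U. if (\<lambda>e. f ` e) ` edges H \<subseteq> S then ?w S else 0)"
    by (rule sum.swap)
  also have "\<dots> \<le> (\<Sum>f\<in>?M. if f \<in> ?I then p ^ num_edges H else 1)"
    by (rule sum_mono) (use inj noninj in auto)
  also have "\<dots> = real (card ?I) * p ^ num_edges H + real (card (?M - ?I))"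
  proof -
    have "?M \<inter> {f. f \<in> ?I} = ?I" "?M \<inter> - {f. f \<in> ?I} = ?M - ?I" by blast+
    then show ?thesis by (simp only: sum.If_cases[OF finM]) simp
  qed
  also have "real (card (?M - ?I)) = ?N - real (card ?I)"
    using finM card_mono[of ?M ?I] by (subst card_Diff_subset) (auto simp: cardM of_nat_diff)
  \<comment> \<open>In the main term all maps are counted instead of the injective ones; the number
    of non-injective maps stays exact.\<close>
  also have "real (card ?I) * p ^ num_edges H \<le> ?N * p ^ num_edges H"
    using finM p(1) card_mono[of ?M ?I] by (intro mult_right_mono) (auto simp flip: cardM)
  finally have "(\<Sum>S\<in>Pow ?U. ?w S * real (card (homs H \<lparr>verts = V, edges = S\<rparr>)))
      \<le> ?N * (p ^ num_edges H + (1 - inj_ratio (num_verts H) (card V)))"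
    by (simp add: cardI algebra_simps)
  then have "(\<Sum>S\<in>Pow ?U. ?w S * real (card (homs H \<lparr>verts = V, edges = S\<rparr>))) / ?N
      \<le> p ^ num_edges H + (1 - inj_ratio (num_verts H) (card V))"
    using N by (simp add: divide_le_eq mult.commute)
  then show ?thesis
    by (simp add: hom_density_def sum_divide_distrib) (simp add: num_verts_def)
qed

lemma average_hom_density_complement_le:
  assumes "is_graph H" "finite V" "V \<noteq> {}" "num_verts H \<le> card V" "0 \<le> p" "p \<le> 1"
  shows "(\<Sum>S\<in>Pow (nsets V 2). binomial_weight p (nsets V 2) S
        * hom_density H (complement \<lparr>verts = V, edges = S\<rparr>))
    \<le> (1 - p) ^ num_edges H + (1 - inj_ratio (num_verts H) (card V))"
proof -
  let ?U = "nsets V 2"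
  have "(\<Sum>S\<in>Pow ?U. binomial_weight p ?U S * hom_density H (complement \<lparr>verts = V, edges = S\<rparr>))
      = (\<Sum>S\<in>Pow ?U. binomial_weight (1 - p) ?U S * hom_density H \<lparr>verts = V, edges = S\<rparr>)"
    \<comment> \<open>Complementation turns G(n, p) into G(n, 1 - p).\<close>
    by (rule sum.reindex_bij_witness[of _ "\<lambda>S. ?U - S" "\<lambda>S. ?U - S"])
       (auto simp: complement_def double_diff binomial_weight_Diff[of _ _ "1 - p", simplified])
  then show ?thesis
    using average_hom_density_le[of H V "1 - p"] assms by simp
qed

text \<open>The weights are nonnegative with sum 1, so some value is at most the average. Averaging
  the combined expression makes one graph serve both terms.\<close>

lemma exists_graph_le_average:
  fixes p a b :: real
  assumes H: "is_graph H1" "is_graph H2" and n: "0 < n" "num_verts H1 \<le> n" "num_verts H2 \<le> n"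
    and p: "0 \<le> p" "p \<le> 1" and a: "0 \<le> a" "0 \<le> b"
  shows "\<exists>F :: nat sgraph. is_graph F \<and> num_verts F = n \<and>
    a * hom_density H1 F + b * hom_density H2 (complement F)
    \<le> a * (p ^ num_edges H1 + (1 - inj_ratio (num_verts H1) n))
      + b * ((1 - p) ^ num_edges H2 + (1 - inj_ratio (num_verts H2) n))"
proof -
  let ?U = "nsets {..<n} 2" and ?F = "\<lambda>S. \<lparr>verts = {..<n}, edges = S\<rparr>"
  let ?w = "binomial_weight p ?U"
  define g where "g S = a * hom_density H1 (?F S) + b * hom_density H2 (complement (?F S))" for S
  define B where "B = a * (p ^ num_edges H1 + (1 - inj_ratio (num_verts H1) n))
      + b * ((1 - p) ^ num_edges H2 + (1 - inj_ratio (num_verts H2) n))"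
  have finU: "finite ?U" by (simp add: finite_imp_finite_nsets)
  have avg: "(\<Sum>S\<in>Pow ?U. ?w S * g S) \<le> B"
  proof -
    have "(\<Sum>S\<in>Pow ?U. ?w S * g S) = a * (\<Sum>S\<in>Pow ?U. ?w S * hom_density H1 (?F S))
        + b * (\<Sum>S\<in>Pow ?U. ?w S * hom_density H2 (complement (?F S)))"
      by (simp add: g_def sum_distrib_left sum.distrib algebra_simps)
    also have "\<dots> \<le> B"
      unfolding B_def
      using average_hom_density_le[of H1 "{..<n}" p]
        average_hom_density_complement_le[of H2 "{..<n}" p] assms
      by (intro add_mono mult_left_mono) (auto simp: lessThan_empty_iff)
    finally show ?thesis .
  qed
  have "\<exists>S\<in>Pow ?U. g S \<le> B"
  proof (rule ccontr)
    assume "\<not> (\<exists>S\<in>Pow ?U. g S \<le> B)"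
    then have gt: "g S > B" if "S \<in> Pow ?U" for S using that by (meson not_le)
    \<comment> \<open>Some weights may vanish, so a set of positive weight is needed to make the
      comparison of the sums strict.\<close>
    have "\<exists>S\<in>Pow ?U. ?w S > 0"
    proof (rule ccontr)
      assume "\<not> ?thesis"
      then have "(\<Sum>S\<in>Pow ?U. ?w S) \<le> 0" by (intro sum_nonpos) (meson not_le)
      then show False using sum_binomial_weight[OF finU, of p] by simp
    qed
    then obtain T where T: "T \<in> Pow ?U" "?w T > 0" by blast
    have "(\<Sum>S\<in>Pow ?U. ?w S * B) < (\<Sum>S\<in>Pow ?U. ?w S * g S)"
      using T gt finU binomial_weight_nonneg[OF p]
      by (intro sum_strict_mono_ex1) (auto intro!: mult_left_mono bexI[of _ T] simp: less_imp_le)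
    also have "(\<Sum>S\<in>Pow ?U. ?w S * B) = B"
      using sum_binomial_weight[OF finU, of p] by (simp flip: sum_distrib_right)
    finally show False using avg by simp
  qed
  then obtain S where "S \<subseteq> ?U" "g S \<le> B" by blast
  then show ?thesis
    using n(1) unfolding g_def B_def
    by (intro exI[of _ "?F S"]) (auto simp: is_graph_def num_verts_def lessThan_empty_iff)
qed

section \<open>The two bounds\<close>

lemma c_lam_le:
  fixes p lam :: real
  assumes G: "graph_enumeration G" and H: "is_graph H1" "is_graph H2"
    and p: "0 \<le> p" "p \<le> 1" and lam: "0 \<le> lam" "lam \<le> 2"
  shows "c_lam G lam H1 H2 \<le> ereal (lam * p ^ num_edges H1 + (2 - lam) * (1 - p) ^ num_edges H2)"
    (is "_ \<le> ereal ?a")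
proof (rule ccontr)
  define val where "val F = lam * hom_density H1 F + (2 - lam) * hom_density H2 (complement F)"
    for F :: "nat sgraph"
  assume "\<not> ?thesis"
  then have "ereal ?a < liminf (\<lambda>k. ereal (val (G k)))"
    by (simp add: c_lam_def val_def)
  then obtain c where c: "?a < c" "ereal c < liminf (\<lambda>k. ereal (val (G k)))"
    by (metis ereal_dense2 less_ereal.simps(1))
  have "eventually (\<lambda>k. c < val (G k)) sequentially"
    using less_LiminfD[OF c(2)] by simp
  then obtain K where K: "\<And>k. k \<ge> K \<Longrightarrow> c < val (G k)"
    by (auto simp: eventually_sequentially)
  let ?b = "\<lambda>n. lam * (p ^ num_edges H1 + (1 - inj_ratio (num_verts H1) n))
      + (2 - lam) * ((1 - p) ^ num_edges H2 + (1 - inj_ratio (num_verts H2) n))"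
  have "?b \<longlonglongrightarrow> lam * (p ^ num_edges H1 + (1 - 1)) + (2 - lam) * ((1 - p) ^ num_edges H2 + (1 - 1))"
    by (intro tendsto_intros inj_ratio_tendsto)
  then have "eventually (\<lambda>n. ?b n < c) sequentially"
    using c(1) by (intro order_tendstoD(2)) auto
  \<comment> \<open>A graph with more vertices than the first \<open>K\<close> listed graphs
    together is isomorphic to none of them, so its index is at least \<open>K\<close>.\<close>
  then have "eventually (\<lambda>n. ?b n < c \<and> 0 < n \<and> num_verts H1 \<le> n \<and> num_verts H2 \<le> n
      \<and> (\<Sum>k<K. num_verts (G k)) < n) sequentially"
    by (intro eventually_conj eventually_gt_at_top eventually_ge_at_top)
  then obtain n where n: "?b n < c" "0 < n" "num_verts H1 \<le> n" "num_verts H2 \<le> n"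
      "(\<Sum>k<K. num_verts (G k)) < n"
    using eventually_happens'[OF sequentially_bot] by blast
  obtain F :: "nat sgraph" where F: "is_graph F" "num_verts F = n" "val F \<le> ?b n"
    using exists_graph_le_average[OF H n(2-4) p lam(1), of "2 - lam"] lam(2)
    unfolding val_def by auto
  obtain k where k: "isomorphic F (G k)"
    using G F(1) by (auto simp: graph_enumeration_def)
  have Gk: "is_graph (G k)" using G by (simp add: graph_enumeration_def)
  have "k \<ge> K"
  proof (rule ccontr)
    assume "\<not> K \<le> k"
    then have "num_verts (G k) \<le> (\<Sum>k<K. num_verts (G k))"
      by (intro member_le_sum) auto
    then show False using n(5) F(2) num_verts_isomorphic[OF k] by simp
  qed
  then have "c < val (G k)" by (rule K)
  also have "val (G k) = val F"
    using hom_density_isomorphic[OF k H(1) F(1) Gk]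
      hom_density_isomorphic[OF isomorphic_complement[OF F(1) k] H(2)] F(1) Gk
    by (simp add: val_def is_graph_complement)
  finally show False using F(3) n(1) by simp
qed

section \<open>Lower bound for a balanced value of \<open>lam\<close>\<close>

lemma power_ge_tangent:
  fixes x p :: real
  assumes "0 \<le> x" "0 < p"
  shows "x ^ n \<ge> p ^ n + n * p ^ (n - 1) * (x - p)"
proof -
  \<comment> \<open>Bernoulli's inequality applies because \<open>x / p - 1\<close> is at least
    -1.\<close>
  have "1 + n * (x / p - 1) \<le> (1 + (x / p - 1)) ^ n"
    using assms by (intro Bernoulli_inequality) simp
  then have "p ^ n * (1 + n * (x / p - 1)) \<le> p ^ n * (x / p) ^ n"
    using assms by (intro mult_left_mono) auto
  moreover have "p ^ n * (x / p) ^ n = x ^ n"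
    using assms by (simp add: power_divide)
  moreover have "p ^ n * (1 + n * (x / p - 1)) = p ^ n + n * p ^ (n - 1) * (x - p)"
    \<comment> \<open>For \<open>n = 0\<close> the truncated exponent \<open>n - 1\<close> is
      harmless, as its coefficient is zero.\<close>
    using assms by (cases n) (auto simp: field_simps)
  ultimately show ?thesis by simp
qed

lemma le_c_lam:
  fixes p lam :: real
  assumes G: "graph_enumeration G" and p: "0 < p" "p < 1" and lam: "0 \<le> lam" "lam \<le> 2"
    and slope: "lam * (num_edges H1 * p ^ (num_edges H1 - 1))
      = (2 - lam) * (num_edges H2 * (1 - p) ^ (num_edges H2 - 1))"
    and S: "sidorenko H1" "sidorenko H2"
  shows "ereal (lam * p ^ num_edges H1 + (2 - lam) * (1 - p) ^ num_edges H2) \<le> c_lam G lam H1 H2"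
    (is "ereal ?a \<le> _")
proof -
  define s where "s = lam * (num_edges H1 * p ^ (num_edges H1 - 1))"
  \<comment> \<open>The error is the common slope \<open>s\<close> times the deficit of the two edge
    densities from 1; it vanishes as the graphs grow.\<close>
  define r where "r k = ?a - s * (1 / real (num_verts (G k)))" for k
  have "r k \<le> lam * hom_density H1 (G k) + (2 - lam) * hom_density H2 (complement (G k))" for k
  proof -
    have Gk: "is_graph (G k)" using G by (simp add: graph_enumeration_def)
    define x where "x = hom_density K2 (G k)"
    define y where "y = hom_density K2 (complement (G k))"
    have nonneg: "x \<ge> 0" "y \<ge> 0" by (simp_all add: x_def y_def hom_density_def)
    have xy: "x + y = 1 - 1 / num_verts (G k)"
      unfolding x_def y_def using Gk by (rule K2_density_complement)
    \<comment> \<open>Both tangent lines have slope \<open>s\<close>, so their linear parts depend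
      on \<open>x\<close> and \<open>y\<close> only through \<open>x + y\<close>.\<close>
    have "r k = ?a + s * (x + y - 1)" by (simp add: r_def xy)
    also have "\<dots> = lam * (p ^ num_edges H1 + num_edges H1 * p ^ (num_edges H1 - 1) * (x - p))
        + (2 - lam) * ((1 - p) ^ num_edges H2
          + num_edges H2 * (1 - p) ^ (num_edges H2 - 1) * (y - (1 - p)))"
    proof -
      have "s * (x + y - 1) = s * (x - p) + s * (y - (1 - p))" by (simp add: algebra_simps)
      also have "s * (y - (1 - p))
          = (2 - lam) * (num_edges H2 * (1 - p) ^ (num_edges H2 - 1)) * (y - (1 - p))"
        by (simp only: s_def slope)
      finally show ?thesis by (simp add: s_def distrib_left mult.assoc)
    qed
    also have "\<dots> \<le> lam * x ^ num_edges H1 + (2 - lam) * y ^ num_edges H2"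
      using nonneg p lam by (intro add_mono mult_left_mono power_ge_tangent) auto
    also have "\<dots> \<le> lam * hom_density H1 (G k) + (2 - lam) * hom_density H2 (complement (G k))"
      using S lam Gk is_graph_complement[OF Gk] unfolding x_def y_def sidorenko_def
      by (intro add_mono mult_left_mono) auto
    finally show ?thesis .
  qed
  then have "liminf (\<lambda>k. ereal (r k)) \<le> c_lam G lam H1 H2"
    unfolding c_lam_def by (intro Liminf_mono) simp
  moreover have "r \<longlonglongrightarrow> ?a - s * 0"
    unfolding r_def
    by (intro tendsto_intros filterlim_compose[OF lim_1_over_n filterlim_num_verts[OF G]])
  then have "liminf (\<lambda>k. ereal (r k)) = ereal ?a"
    by (intro lim_imp_Liminf) (auto simp: lim_ereal)
  ultimately show ?thesis by simp
qed

theorem theorem1p8: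
  fixes G :: "nat \<Rightarrow> nat sgraph" and H1 :: "'a sgraph" and H2 :: "'b sgraph" and p :: real
  assumes "graph_enumeration G"
    and "is_graph H1" and "is_graph H2"
    and "num_edges H1 \<ge> 1" and "num_edges H2 \<ge> 1"
    and "0 < p" and "p < 1"
    and "p ^ num_edges H1 = (1 - p) ^ num_edges H2"
    and "sidorenko H1" and "sidorenko H2"
  shows "c_sup G H1 H2 = ereal (2 * p ^ num_edges H1)
    \<and> c_sup G H1 H2 = ereal (2 * (1 - p) ^ num_edges H2)"
proof -
  \<comment> \<open>The equation for \<open>p\<close> makes both bounds independent of
    \<open>lam\<close>. Hence the upper bound passes to the supremum, and a single
    \<open>lam\<close> suffices for the lower one.\<close>
  have val: "lam * p ^ num_edges H1 + (2 - lam) * (1 - p) ^ num_edges H2 = 2 * p ^ num_edges H1"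
    for lam by (simp flip: assms(8) add: algebra_simps)
  define u where "u = num_edges H1 * p ^ (num_edges H1 - 1)"
  define v where "v = num_edges H2 * (1 - p) ^ (num_edges H2 - 1)"
  \<comment> \<open>The solution of \<open>lam * u = (2 - lam) * v\<close>, the equality of slopes;
    it lies between 0 and 2 since \<open>u\<close> and \<open>v\<close> are positive.\<close>
  define lam where "lam = 2 * v / (u + v)"
  have uv: "u > 0" "v > 0" using assms(4-7) by (simp_all add: u_def v_def)
  then have lam: "0 \<le> lam" "lam \<le> 2" by (simp_all add: lam_def field_simps)
  have "lam * u = (2 - lam) * v" using uv by (simp add: lam_def field_simps)
  then have "ereal (2 * p ^ num_edges H1) \<le> c_lam G lam H1 H2"
    using le_c_lam[of G p lam H1 H2] assms lam val by (simp add: u_def v_def)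
  also have "\<dots> \<le> c_sup G H1 H2"
    unfolding c_sup_def using lam by (intro SUP_upper) simp
  finally have "ereal (2 * p ^ num_edges H1) \<le> c_sup G H1 H2" .
  moreover have "c_sup G H1 H2 \<le> ereal (2 * p ^ num_edges H1)"
    unfolding c_sup_def
    using c_lam_le[OF assms(1-3), of p] assms(6,7) val by (intro SUP_least) auto
  ultimately show ?thesis using assms(8) by (metis order_antisym)
qed

end
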